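(* For any finite simple connected graph $G$ and any $\ell\ge 2$, either $c'_\ell(G)=c_\ell(G)$ or $c(G)\le c_\ell(G)\le c(G)+1$.
   Context: $\ell$-visibility Cops and Robber on a graph $G$: in round 0 a set of cops each choose a vertex, then a single robber chooses a vertex. In each subsequent round, every cop moves to a neighbouring vertex or stays put, and then the robber moves to a neighbouring vertex or stays put. The robber always knows the positions of all cops. The cops know the robber's position only at moments when some cop and the robber occupy vertices $x,y$ with $d(x,y)\le \ell$. The cops capture the robber if a cop occupies the robber's vertex. $c_\ell(G)$ is the minimum number of cops that can guarantee capture; $c'_\ell(G)$ is the minimum number of cops that can guarantee that at some moment some cop is within distance $\ell$ of the robber; $c(G)$ is the classical cop number (cops always know the robber's position). *)

theory Defs
  imports "Graph_Theory.Graph_Theory"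
begin

text \<open>
  Finite simple graphs are rendered by the locale \<open>pair_graph\<close>: a finite vertex set with a
  finite, symmetric, loop-free set of arcs. The predicate \<open>connected\<close> on digraphs includes
  that there is at least one vertex.
\<close>

definition gdist :: "'a pair_pre_digraph \<Rightarrow> 'a \<Rightarrow> 'a \<Rightarrow> ereal" where
  "gdist G u v = wf_digraph.\<mu> (with_proj G) (\<lambda>_. 1) u v"

definition legal_step :: "'a pair_pre_digraph \<Rightarrow> 'a \<Rightarrow> 'a \<Rightarrow> bool" where
  "legal_step G u v \<longleftrightarrow> v = u \<or> (u, v) \<in> parcs G"

text \<open>
  The position of \<open>k\<close> cops is a list of length \<open>k\<close>; several cops may share a vertex.

  A cop strategy maps the list of all observations made so far to the next cop position. An
  observation is \<open>Some r\<close> if the robber is seen at \<open>r\<close>, and \<open>None\<close> if he is not seen. The own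
  earlier positions of the cops are determined by the strategy and the observations.

  A robber strategy maps the list of all cop positions so far (including the move the cops have
  just made) to the next position of the robber.
\<close>

type_synonym 'a cop_strategy = "'a option list \<Rightarrow> 'a list"
type_synonym 'a robber_strategy = "'a list list \<Rightarrow> 'a"

definition observe :: "('a list \<Rightarrow> 'a \<Rightarrow> bool) \<Rightarrow> 'a list \<Rightarrow> 'a \<Rightarrow> 'a option" where
  "observe vis C r = (if vis C r then Some r else None)"

text \<open>
  The cop positions and the observations up to the end of round \<open>t\<close>. Every round after round 0
  contributes two observations: one after the move of the cops, when the robber is still at his
  old vertex, and one after the move of the robber.
\<close>

primrec history ::
  "('a list \<Rightarrow> 'a \<Rightarrow> bool) \<Rightarrow> 'a cop_strategy \<Rightarrow> 'a robber_strategy \<Rightarrow> nat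
    \<Rightarrow> 'a list list \<times> 'a option list" where
  "history vis \<sigma> \<rho> 0 = (let C = \<sigma> [] in ([C], [observe vis C (\<rho> [C])]))"
| "history vis \<sigma> \<rho> (Suc t) =
    (let (Cs, os) = history vis \<sigma> \<rho> t; C = \<sigma> os
     in (Cs @ [C], os @ [observe vis C (\<rho> Cs), observe vis C (\<rho> (Cs @ [C]))]))"

definition cops_at ::
  "('a list \<Rightarrow> 'a \<Rightarrow> bool) \<Rightarrow> 'a cop_strategy \<Rightarrow> 'a robber_strategy \<Rightarrow> nat \<Rightarrow> 'a list" where
  "cops_at vis \<sigma> \<rho> t = last (fst (history vis \<sigma> \<rho> t))"

definition robber_at ::
  "('a list \<Rightarrow> 'a \<Rightarrow> bool) \<Rightarrow> 'a cop_strategy \<Rightarrow> 'a robber_strategy \<Rightarrow> nat \<Rightarrow> 'a" where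
  "robber_at vis \<sigma> \<rho> t = \<rho> (fst (history vis \<sigma> \<rho> t))"

definition legal_cops :: "'a pair_pre_digraph \<Rightarrow> nat \<Rightarrow> (nat \<Rightarrow> 'a list) \<Rightarrow> bool" where
  "legal_cops G k c \<longleftrightarrow>
    length (c 0) = k \<and> set (c 0) \<subseteq> pverts G \<and>
    (\<forall>t. list_all2 (legal_step G) (c t) (c (Suc t)))"

definition legal_robber :: "'a pair_pre_digraph \<Rightarrow> (nat \<Rightarrow> 'a) \<Rightarrow> bool" where
  "legal_robber G r \<longleftrightarrow> r 0 \<in> pverts G \<and> (\<forall>t. legal_step G (r t) (r (Suc t)))"

text \<open>
  The moments of a play are those after the robber's placement or move (cops at \<open>c t\<close>, robber at
  \<open>r t\<close>) and those after the cops' move (cops at \<open>c (Suc t)\<close>, robber at \<open>r t\<close>).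
\<close>

definition some_moment ::
  "('a list \<Rightarrow> 'a \<Rightarrow> bool) \<Rightarrow> (nat \<Rightarrow> 'a list) \<Rightarrow> (nat \<Rightarrow> 'a) \<Rightarrow> bool" where
  "some_moment goal c r \<longleftrightarrow> (\<exists>t. goal (c t) (r t) \<or> goal (c (Suc t)) (r t))"

definition cops_win ::
  "'a pair_pre_digraph \<Rightarrow> ('a list \<Rightarrow> 'a \<Rightarrow> bool) \<Rightarrow> ('a list \<Rightarrow> 'a \<Rightarrow> bool) \<Rightarrow> nat \<Rightarrow> bool" where
  "cops_win G vis goal k \<longleftrightarrow>
    (\<exists>\<sigma>. \<forall>\<rho>. legal_robber G (robber_at vis \<sigma> \<rho>) \<longrightarrow>
      legal_cops G k (cops_at vis \<sigma> \<rho>) \<and>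
      some_moment goal (cops_at vis \<sigma> \<rho>) (robber_at vis \<sigma> \<rho>))"

definition in_range :: "'a pair_pre_digraph \<Rightarrow> nat \<Rightarrow> 'a list \<Rightarrow> 'a \<Rightarrow> bool" where
  "in_range G l C r \<longleftrightarrow> (\<exists>x \<in> set C. gdist G x r \<le> ereal (real l))"

definition captured :: "'a list \<Rightarrow> 'a \<Rightarrow> bool" where
  "captured C r \<longleftrightarrow> r \<in> set C"

text \<open>The numbers \<open>c(G)\<close>, \<open>c\<^sub>l(G)\<close> and \<open>c'\<^sub>l(G)\<close>, in this order.\<close>

definition cop_number :: "'a pair_pre_digraph \<Rightarrow> nat" where
  "cop_number G = (LEAST k. cops_win G (\<lambda>_ _. True) captured k)"

definition vis_cop_number :: "nat \<Rightarrow> 'a pair_pre_digraph \<Rightarrow> nat" where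
  "vis_cop_number l G = (LEAST k. cops_win G (in_range G l) captured k)"

definition vis_seeing_number :: "nat \<Rightarrow> 'a pair_pre_digraph \<Rightarrow> nat" where
  "vis_seeing_number l G = (LEAST k. cops_win G (in_range G l) (in_range G l) k)"

end

theory Submission
  imports Defs
begin

text \<open>
  The crux is that \<open>max c'\<^sub>l (c + 1)\<close> cops capture the robber. Until the first sighting they follow
  a strategy for seeing him. Then a cop who sees him becomes the tracker and always steps towards
  the last vertex at which he was seen, while the others play a classical positional strategy
  against that vertex. If the robber is ever seen when the cops are to move, the tracker sees him
  at all later such moments, so the classical strategy runs with full information and captures
  him. Otherwise the tracker still sees him after every move of the cops, so the others chase his
  position one round ago. When they capture this shadow, the robber gets at most two steps away
  before the cops move again, and since \<open>l \<ge> 2\<close> he is then seen after all.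
\<close>

section \<open>Moves, walks and graph distance\<close>

lemma legal_step_refl [simp]: "legal_step G u u"
  by (simp add: legal_step_def)

lemma legal_steps_mono:
  assumes "(legal_step G ^^ m) u v" and "m \<le> n"
  shows "(legal_step G ^^ n) u v"
  using assms(2,1)
proof (induction n rule: dec_induct)
  case (step n)
  then show ?case using relpowp_Suc_I[of n "legal_step G" u v v] by simp
qed

lemma legal_step_in_verts:
  assumes "pair_graph G" and "legal_step G u v" and "u \<in> pverts G"
  shows "v \<in> pverts G"
proof -
  interpret pair_graph G by fact
  show ?thesis using assms(2,3) arc_snd_in_verts[of "(u, v)"] by (auto simp: legal_step_def)
qed

lemma legal_cops_step_in_verts:
  assumes "pair_graph G" and "list_all2 (legal_step G) C C'" and "set C \<subseteq> pverts G"
  shows "set C' \<subseteq> pverts G"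
proof
  fix v assume "v \<in> set C'"
  then obtain i where i: "i < length C'" "v = C' ! i" by (auto simp: in_set_conv_nth)
  then have "legal_step G (C ! i) v" "C ! i \<in> set C"
    using assms(2) by (auto simp: list_all2_conv_all_nth)
  then show "v \<in> pverts G" using assms legal_step_in_verts by (metis subsetD)
qed

lemma legal_robber_in_verts:
  assumes "pair_graph G" and "legal_robber G r"
  shows "r t \<in> pverts G"
proof (induction t)
  case 0
  then show ?case using assms by (simp add: legal_robber_def)
next
  case (Suc t)
  then show ?case using assms legal_step_in_verts unfolding legal_robber_def by metis
qed

lemma legal_steps_imp_awalk:
  assumes "pair_graph G"
  shows "(legal_step G ^^ n) u v \<Longrightarrow> u \<in> pverts G \<Longrightarrow>
    \<exists>p. pre_digraph.awalk (with_proj G) u p v \<and> length p \<le> n"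
proof (induction n arbitrary: u)
  case 0
  interpret pair_graph G by fact
  show ?case using 0 by (auto simp: awalk_Nil_iff)
next
  case (Suc n)
  interpret pair_graph G by fact
  obtain w where w: "legal_step G u w" "(legal_step G ^^ n) w v"
    using Suc.prems(1) by (blast dest: relpowp_Suc_D2)
  have "w \<in> pverts G" using legal_step_in_verts[OF assms] w(1) Suc.prems(2) .
  then obtain p where p: "awalk w p v" "length p \<le> n" using Suc.IH w(2) by blast
  show ?case
  proof (cases "w = u")
    case True
    then show ?thesis using p by (auto intro: le_SucI)
  next
    case False
    then have "awalk u ((u, w) # p) v"
      using w(1) p(1) by (auto simp: legal_step_def awalk_Cons_iff)
    then show ?thesis using p(2) by (metis Suc_le_mono length_Cons)
  qed
qed

lemma awalk_imp_legal_steps: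
  assumes "pair_graph G"
  shows "pre_digraph.awalk (with_proj G) u p v \<Longrightarrow> (legal_step G ^^ length p) u v"
proof (induction p arbitrary: u)
  case Nil
  interpret pair_graph G by fact
  show ?case using Nil by (auto simp: awalk_Nil_iff)
next
  case (Cons e p)
  interpret pair_graph G by fact
  have "legal_step G u (snd e)" "awalk (snd e) p v"
    using Cons.prems by (auto simp: awalk_Cons_iff legal_step_def)
  then have "(legal_step G ^^ Suc (length p)) u v" using Cons.IH relpowp_Suc_I2 by metis
  then show ?case by simp
qed

text \<open>Since a legal step may stay put, \<open>n\<close> legal steps amount to a walk of at
  most \<open>n\<close> arcs. The start must be a vertex because staying put is a legal step even
  outside the graph.\<close>

lemma gdist_le_iff:
  assumes "pair_graph G" and "u \<in> pverts G"
  shows "gdist G u v \<le> ereal (real n) \<longleftrightarrow> (legal_step G ^^ n) u v"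
proof -
  interpret pair_graph G by fact
  have cost: "awalk_cost (\<lambda>_. 1) p = real (length p)" for p :: "('a \<times> 'a) list"
    by (induction p) simp_all
  show ?thesis
  proof
    assume le: "gdist G u v \<le> ereal (real n)"
    \<comment> \<open>The strict bound lets the infimum yield a walk of cost below
      \<open>n + 1\<close>; its cost is an integer, so its length is at most
      \<open>n\<close>.\<close>
    have "\<mu> (\<lambda>_. 1) u v < ereal (real n + 1)"
      using le by (simp add: gdist_def less_ereal.simps(1) order.strict_trans1)
    then obtain p where p: "awalk u p v" "ereal (awalk_cost (\<lambda>_. 1) p) < ereal (real n + 1)"
      unfolding \<mu>_def by (auto simp: INF_less_iff)
    then have "length p \<le> n" unfolding cost by simp
    then show "(legal_step G ^^ n) u v"
      by (rule legal_steps_mono[OF awalk_imp_legal_steps[OF assms(1) p(1)]])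
  next
    assume "(legal_step G ^^ n) u v"
    then obtain p where p: "awalk u p v" "length p \<le> n"
      using legal_steps_imp_awalk[OF assms(1) _ assms(2)] by blast
    have "gdist G u v \<le> ereal (awalk_cost (\<lambda>_. 1) p)"
      unfolding gdist_def by (rule min_cost_le_walk_cost[OF p(1)])
    also have "\<dots> \<le> ereal (real n)" unfolding cost using p(2) by simp
    finally show "gdist G u v \<le> ereal (real n)" .
  qed
qed

text \<open>For a vertex \<open>u\<close> this is d(u,v) \<le> n, kept as a chain of moves so that a
  step of either player shifts the bound by one.\<close>

definition near :: "'a pair_pre_digraph \<Rightarrow> nat \<Rightarrow> 'a \<Rightarrow> 'a \<Rightarrow> bool" where
  "near G n u v \<longleftrightarrow> (legal_step G ^^ n) u v"

lemma near_self: "near G n u u"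
  unfolding near_def by (rule legal_steps_mono[of 0]) simp_all

lemma near_mono: "near G m u v \<Longrightarrow> m \<le> n \<Longrightarrow> near G n u v"
  unfolding near_def by (rule legal_steps_mono)

lemma near_SucI: "near G n u v \<Longrightarrow> legal_step G v w \<Longrightarrow> near G (Suc n) u w"
  unfolding near_def by (rule relpowp_Suc_I)

lemma near_SucD: "near G (Suc n) u v \<Longrightarrow> \<exists>w. legal_step G u w \<and> near G n w v"
  unfolding near_def by (rule relpowp_Suc_D2)

lemma in_range_iff:
  assumes "pair_graph G" and "set C \<subseteq> pverts G"
  shows "in_range G l C q \<longleftrightarrow> (\<exists>x \<in> set C. near G l x q)"
  unfolding in_range_def near_def using gdist_le_iff[OF assms(1)] assms(2) by (metis subsetD)

text \<open>Finiteness turns connectedness into one number of steps for all pairs, so that all cops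
  can reach prescribed vertices at the same time.\<close>

lemma connected_bounded_legal_steps:
  assumes "pair_graph G" and "connected (with_proj G)"
  shows "\<exists>n. \<forall>u \<in> pverts G. \<forall>v \<in> pverts G. (legal_step G ^^ n) u v"
proof -
  interpret pair_graph G by fact
  have "\<exists>n. (legal_step G ^^ n) u v" if "u \<in> pverts G" "v \<in> pverts G" for u v
  proof -
    have "strongly_connected (with_proj G)"
      using symmetric_connected_imp_strongly_connected sym_arcs assms(2) by blast
    then have "u \<rightarrow>\<^sup>*\<^bsub>with_proj G\<^esub> v" using that by (auto simp: strongly_connected_def)
    then show ?thesis using awalk_imp_legal_steps[OF assms(1)] reachable_awalk by blast
  qed
  then obtain N where N: "\<And>u v. u \<in> pverts G \<Longrightarrow> v \<in> pverts G \<Longrightarrow> (legal_step G ^^ N u v) u v"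
    by metis
  let ?A = "(\<lambda>(u, v). N u v) ` (pverts G \<times> pverts G)"
  have "(legal_step G ^^ Max ?A) u v" if "u \<in> pverts G" "v \<in> pverts G" for u v
  proof (rule legal_steps_mono[OF N[OF that]])
    show "N u v \<le> Max ?A"
      using that pair_finite_verts by (intro Max_ge) (auto intro!: image_eqI[of _ _ "(u, v)"])
  qed
  then show ?thesis by blast
qed

section \<open>Strategies as machines, and runs against a trajectory\<close>

text \<open>
  Strategies are handled as machines with a memory: \<open>ini\<close> digests the observation of round 0,
  \<open>upd\<close> the two observations of a later round, and \<open>nxt\<close> reads off the next cop position.
\<close>

definition run :: "('a list \<Rightarrow> 'a \<Rightarrow> bool) \<Rightarrow> 'a list \<Rightarrow> ('a option \<Rightarrow> 's) \<Rightarrow>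
    ('s \<Rightarrow> 'a option \<Rightarrow> 'a option \<Rightarrow> 's) \<Rightarrow> ('s \<Rightarrow> 'a list) \<Rightarrow>
    (nat \<Rightarrow> 'a) \<Rightarrow> (nat \<Rightarrow> 'a list) \<Rightarrow> (nat \<Rightarrow> 's) \<Rightarrow> bool" where
  "run vis C ini upd nxt r c s \<longleftrightarrow>
    c 0 = C \<and> s 0 = ini (observe vis C (r 0)) \<and>
    (\<forall>t. c (Suc t) = nxt (s t) \<and>
      s (Suc t) = upd (s t) (observe vis (c (Suc t)) (r t))
        (observe vis (c (Suc t)) (r (Suc t))))"

abbreviation strategy_run :: "('a list \<Rightarrow> 'a \<Rightarrow> bool) \<Rightarrow> 'a cop_strategy \<Rightarrow>
    (nat \<Rightarrow> 'a) \<Rightarrow> (nat \<Rightarrow> 'a list) \<Rightarrow> (nat \<Rightarrow> 'a option list) \<Rightarrow> bool" where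
  "strategy_run vis \<sigma> \<equiv> run vis (\<sigma> []) (\<lambda>x. [x]) (\<lambda>os x y. os @ [x, y]) \<sigma>"

lemma strategy_run_history:
  "strategy_run vis \<sigma> (robber_at vis \<sigma> \<rho>) (cops_at vis \<sigma> \<rho>) (\<lambda>t. snd (history vis \<sigma> \<rho> t))"
  by (auto simp: run_def cops_at_def robber_at_def Let_def split: prod.splits)

lemma run_unique:
  assumes "run vis C ini upd nxt r c s" and "run vis C ini upd nxt r c' s'"
  shows "c = c' \<and> s = s'"
proof -
  have "c t = c' t \<and> s t = s' t" for t
    using assms by (induction t) (simp_all add: run_def)
  then show ?thesis by blast
qed

lemma run_exists: "\<exists>c s. run vis C ini upd nxt r c s"
proof -
  define play where "play = rec_nat (C, ini (observe vis C (r 0))) (\<lambda>t (_, s).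
    (nxt s, upd s (observe vis (nxt s) (r t)) (observe vis (nxt s) (r (Suc t)))))"
  have "run vis C ini upd nxt r (\<lambda>t. fst (play t)) (\<lambda>t. snd (play t))"
    by (auto simp: run_def play_def split: prod.splits)
  then show ?thesis by blast
qed

text \<open>Against a fixed \<open>\<sigma>\<close> a robber strategy matters only through the
  trajectory it produces, so \<open>\<sigma>\<close> can be tested on arbitrary legal
  trajectories.\<close>

lemma cops_win_strategy:
  assumes "cops_win G vis goal k"
  obtains \<sigma> where "\<And>r c os. legal_robber G r \<Longrightarrow> strategy_run vis \<sigma> r c os \<Longrightarrow>
    legal_cops G k c \<and> some_moment goal c r"
proof -
  obtain \<sigma> where \<sigma>: "\<And>\<rho>. legal_robber G (robber_at vis \<sigma> \<rho>) \<Longrightarrow>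
      legal_cops G k (cops_at vis \<sigma> \<rho>) \<and>
      some_moment goal (cops_at vis \<sigma> \<rho>) (robber_at vis \<sigma> \<rho>)"
    using assms by (auto simp: cops_win_def)
  show ?thesis
  proof
    fix r c os assume r: "legal_robber G r" and run: "strategy_run vis \<sigma> r c os"
    \<comment> \<open>This robber follows \<open>r\<close> whatever the cops do. He tells the round
      from the number of cop positions, which is \<open>Suc t\<close> in round
      \<open>t\<close>.\<close>
    define \<rho> where "\<rho> = (\<lambda>Cs :: 'a list list. r (length Cs - 1))"
    have "length (fst (history vis \<sigma> \<rho> t)) = Suc t" for t
      by (induction t) (auto simp: Let_def split: prod.splits)
    then have "robber_at vis \<sigma> \<rho> = r" by (auto simp: robber_at_def \<rho>_def)
    moreover from this have "cops_at vis \<sigma> \<rho> = c"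
      using run_unique[OF run] strategy_run_history[of vis \<sigma> \<rho>] by auto
    ultimately show "legal_cops G k c \<and> some_moment goal c r" using \<sigma>[of \<rho>] r by auto
  qed
qed

fun digest :: "('s \<Rightarrow> 'b \<Rightarrow> 'b \<Rightarrow> 's) \<Rightarrow> 's \<Rightarrow> 'b list \<Rightarrow> 's" where
  "digest upd s (x # y # os) = digest upd (upd s x y) os"
| "digest upd s _ = s"

lemma digest_snoc:
  "even (length os) \<Longrightarrow> digest upd s (os @ [x, y]) = upd (digest upd s os) x y"
  by (induction upd s os rule: digest.induct) auto

text \<open>The memory is determined by the observations, so a strategy on observation lists can
  recompute it by replaying them.\<close>

lemma cops_win_machine:
  fixes ini :: "'a option \<Rightarrow> 's"
  assumes win: "\<And>r c s. legal_robber G r \<Longrightarrow> run vis C ini upd nxt r c s \<Longrightarrow>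
    legal_cops G k c \<and> some_moment goal c r"
  shows "cops_win G vis goal k"
proof -
  define \<sigma> where "\<sigma> os =
    (case os of [] \<Rightarrow> C | x # xs \<Rightarrow> nxt (digest upd (ini x) xs))" for os
  have "legal_cops G k (cops_at vis \<sigma> \<rho>) \<and>
      some_moment goal (cops_at vis \<sigma> \<rho>) (robber_at vis \<sigma> \<rho>)"
    if r: "legal_robber G (robber_at vis \<sigma> \<rho>)" for \<rho>
  proof (rule win[OF r])
    let ?os = "\<lambda>t. snd (history vis \<sigma> \<rho> t)"
    define s where "s t = digest upd (ini (hd (?os t))) (tl (?os t))" for t
    note run = strategy_run_history[of vis \<sigma> \<rho>, unfolded run_def]
    have os: "?os t \<noteq> [] \<and> even (length (tl (?os t)))" for t
      using run by (induction t) auto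
    have nxt: "\<sigma> (?os t) = nxt (s t)" for t
      using os[of t] by (cases "?os t") (auto simp: \<sigma>_def s_def)
    show "run vis C ini upd nxt (robber_at vis \<sigma> \<rho>) (cops_at vis \<sigma> \<rho>) s"
      unfolding run_def
    proof (intro conjI allI)
      show "cops_at vis \<sigma> \<rho> 0 = C" using run by (simp add: \<sigma>_def)
      then show "s 0 = ini (observe vis C (robber_at vis \<sigma> \<rho> 0))"
        using run by (simp add: s_def)
      fix t
      show "cops_at vis \<sigma> \<rho> (Suc t) = nxt (s t)" using run nxt by auto
      show "s (Suc t) = upd (s t) (observe vis (cops_at vis \<sigma> \<rho> (Suc t)) (robber_at vis \<sigma> \<rho> t))
        (observe vis (cops_at vis \<sigma> \<rho> (Suc t)) (robber_at vis \<sigma> \<rho> (Suc t)))"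
        using os[of t] run by (auto simp: s_def digest_snoc simp del: history.simps)
    qed
  qed
  then show ?thesis unfolding cops_win_def by blast
qed

section \<open>The classical game: bounded wins and positional strategies\<close>

text \<open>Backward induction for the fully visible game with the cops to move. Capture by the move
  to \<open>C'\<close> is a separate alternative because it precedes the robber's reply.\<close>

primrec wins_within :: "'a pair_pre_digraph \<Rightarrow> nat \<Rightarrow> 'a list \<Rightarrow> 'a \<Rightarrow> bool" where
  "wins_within G 0 C q \<longleftrightarrow> q \<in> set C"
| "wins_within G (Suc n) C q \<longleftrightarrow> wins_within G n C q \<or>
    (\<exists>C'. list_all2 (legal_step G) C C' \<and>
      (q \<in> set C' \<or> (\<forall>q'. legal_step G q q' \<longrightarrow> wins_within G n C' q')))"

lemma wins_within_mono: "wins_within G m C q \<Longrightarrow> m \<le> n \<Longrightarrow> wins_within G n C q"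
  by (rotate_tac, induction n rule: dec_induct) simp_all

text \<open>The robber has finitely many replies. If each were lost within some number of rounds,
  the maximum of these numbers would bound them all, and \<open>C\<close> would be won within one
  more round.\<close>

lemma robber_evades:
  assumes "pair_graph G" and "q \<in> pverts G" and "list_all2 (legal_step G) C C'"
    and evades: "\<And>n. \<not> wins_within G n C q"
  shows "\<exists>q'. legal_step G q q' \<and> (\<forall>n. \<not> wins_within G n C' q')"
proof (rule ccontr)
  interpret pair_graph G by fact
  assume "\<not> ?thesis"
  then obtain N where N: "\<And>q'. legal_step G q q' \<Longrightarrow> wins_within G (N q') C' q'" by metis
  have "{q'. legal_step G q q'} \<subseteq> pverts G"
    using legal_step_in_verts[OF assms(1)] assms(2) by blast
  then have fin: "finite {q'. legal_step G q q'}" using pair_finite_verts finite_subset by blast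
  have "wins_within G (Max (N ` {q'. legal_step G q q'})) C' q'" if "legal_step G q q'" for q'
    using that fin by (intro wins_within_mono[OF N[OF that]]) simp
  then have "wins_within G (Suc (Max (N ` {q'. legal_step G q q'}))) C q"
    using assms(3) by auto
  then show False using evades by blast
qed

text \<open>A robber who starts at a vertex not lost in any bounded number of rounds can always
  reply with another such vertex, and is never caught. So a winning strategy yields a bound for
  every starting vertex.\<close>

lemma classical_win_within:
  assumes G: "pair_graph G" and "cops_win G (\<lambda>_ _. True) captured k" and "pverts G \<noteq> {}"
  obtains C0 where "length C0 = k" and "set C0 \<subseteq> pverts G"
    and "\<And>q. q \<in> pverts G \<Longrightarrow> \<exists>n. wins_within G n C0 q"
proof -
  obtain \<sigma> where \<sigma>: "\<And>r c os. legal_robber G r \<Longrightarrow> strategy_run (\<lambda>_ _. True) \<sigma> r c os \<Longrightarrow>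
      legal_cops G k c \<and> some_moment captured c r"
    using cops_win_strategy[OF assms(2)] by blast
  \<comment> \<open>Staying put when no evading reply exists keeps his play legal in every
    case.\<close>
  define evade where "evade C q = (if \<exists>q'. legal_step G q q' \<and> (\<forall>n. \<not> wins_within G n C q')
    then SOME q'. legal_step G q q' \<and> (\<forall>n. \<not> wins_within G n C q') else q)" for C q
  have evade_legal: "legal_step G q (evade C q)" for C q
    unfolding evade_def
    using someI_ex[of "\<lambda>q'. legal_step G q q' \<and> (\<forall>n. \<not> wins_within G n C q')"] by auto
  have evade: "\<not> wins_within G n C (evade C q)"
    if "\<exists>q'. legal_step G q q' \<and> (\<forall>n. \<not> wins_within G n C q')" for n C q
    unfolding evade_def using someI_ex[OF that] that by auto
  \<comment> \<open>Under full visibility the observations are just the robber's vertices before and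
    after his move, so cops, robber and observations can be built by one recursion.\<close>
  define play where "play q0 = rec_nat (\<sigma> [], q0, [Some q0]) (\<lambda>_ (C, q, os).
    (\<sigma> os, evade (\<sigma> os) q, os @ [Some q, Some (evade (\<sigma> os) q)]))" for q0
  define c where "c q0 t = fst (play q0 t)" for q0 t
  define r where "r q0 t = fst (snd (play q0 t))" for q0 t
  define os where "os q0 t = snd (snd (play q0 t))" for q0 t
  have init: "c q0 0 = \<sigma> []" "r q0 0 = q0" "os q0 0 = [Some q0]" for q0
    by (simp_all add: c_def r_def os_def play_def)
  have step: "c q0 (Suc t) = \<sigma> (os q0 t)" "r q0 (Suc t) = evade (c q0 (Suc t)) (r q0 t)"
    "os q0 (Suc t) = os q0 t @ [Some (r q0 t), Some (r q0 (Suc t))]" for q0 t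
    by (auto simp: c_def r_def os_def play_def split: prod.splits)
  have legal: "legal_robber G (r q0)" if "q0 \<in> pverts G" for q0
    using that by (auto simp: legal_robber_def init step evade_legal)
  have win: "legal_cops G k (c q0) \<and> some_moment captured (c q0) (r q0)"
    if "q0 \<in> pverts G" for q0
    using \<sigma>[OF legal[OF that], of "c q0" "os q0"] by (auto simp: run_def init step observe_def)
  show ?thesis
  proof
    obtain v where "v \<in> pverts G" using assms(3) by blast
    then show "length (\<sigma> []) = k" "set (\<sigma> []) \<subseteq> pverts G"
      using win[of v] init by (simp_all add: legal_cops_def)
    fix q0 assume q0: "q0 \<in> pverts G"
    show "\<exists>n. wins_within G n (\<sigma> []) q0"
    proof (rule ccontr)
      assume contr: "\<nexists>n. wins_within G n (\<sigma> []) q0"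
      have cstep: "list_all2 (legal_step G) (c q0 t) (c q0 (Suc t))" for t
        using win[OF q0] by (simp add: legal_cops_def)
      have evaded: "\<not> wins_within G n (c q0 t) (r q0 t)" for n t
      proof (induction t arbitrary: n)
        case 0
        then show ?case using contr by (simp add: init)
      next
        case (Suc t)
        then show ?case
          using robber_evades[OF G legal_robber_in_verts[OF G legal[OF q0]] cstep] evade step(2)
          by metis
      qed
      obtain t where "r q0 t \<in> set (c q0 t) \<or> r q0 t \<in> set (c q0 (Suc t))"
        using win[OF q0] by (auto simp: some_moment_def captured_def)
      \<comment> \<open>\<open>evaded\<close> with bound \<open>0\<close> excludes capture before
        the cops' move, and with bound \<open>Suc 0\<close> capture by that move.\<close>
      then show False
        using evaded[of 0 t] evaded[of "Suc 0" t] cstep[of t] by auto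
    qed
  qed
qed

text \<open>
  The cops may first walk to the initial position of their strategy, so a win does not depend on
  where they start.
\<close>

lemma classical_win_from_anywhere:
  assumes G: "pair_graph G" and "connected (with_proj G)"
    and "cops_win G (\<lambda>_ _. True) captured k"
    and C: "length C = k" "set C \<subseteq> pverts G" and q: "q \<in> pverts G"
  shows "\<exists>n. wins_within G n C q"
proof -
  obtain C0 where C0: "length C0 = k" "set C0 \<subseteq> pverts G"
      "\<And>q. q \<in> pverts G \<Longrightarrow> \<exists>n. wins_within G n C0 q"
    using classical_win_within[OF assms(1,3)] q by (metis emptyE)
  obtain N where N: "\<forall>u \<in> pverts G. \<forall>v \<in> pverts G. (legal_step G ^^ N) u v"
    using connected_bounded_legal_steps[OF assms(1,2)] by blast
  \<comment> \<open>Induction on the number \<open>m\<close> of rounds left for the walk to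
    \<open>C0\<close>, for all \<open>q\<close> at once since the robber moves meanwhile.\<close>
  have "\<exists>n. wins_within G n C q"
    if "list_all2 (legal_step G ^^ m) C C0" "set C \<subseteq> pverts G" "q \<in> pverts G" for m C q
    using that
  proof (induction m arbitrary: C q)
    case 0
    then have "C = C0" by (simp add: list.rel_eq eq_OO)
    then show ?case using C0(3) 0 by blast
  next
    case (Suc m)
    have "legal_step G ^^ Suc m = legal_step G OO legal_step G ^^ m"
      by (simp add: relpowp_commute)
    then obtain C' where C': "list_all2 (legal_step G) C C'" "list_all2 (legal_step G ^^ m) C' C0"
      using Suc.prems(1) by (auto simp: list.rel_compp)
    have "\<exists>n. wins_within G n C' q'" if "q' \<in> pverts G" for q'
      using Suc.IH[OF C'(2) _ that] legal_cops_step_in_verts[OF G C'(1)] Suc.prems(2) by blast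
    then show ?case
      using robber_evades[OF G Suc.prems(3) C'(1)] legal_step_in_verts[OF G] Suc.prems(3) by blast
  qed
  moreover have "list_all2 (legal_step G ^^ N) C C0"
    using N C C0 by (auto simp: list_all2_conv_all_nth subset_iff)
  ultimately show ?thesis using C(2) q by blast
qed

text \<open>The move is the one for the least winning bound. It decreases every winning bound at
  once, so \<open>f\<close> needs no counter of remaining rounds.\<close>

lemma positional_strategy:
  "\<exists>f. (\<forall>C q. list_all2 (legal_step G) C (f C q)) \<and>
    (\<forall>n C q. wins_within G n C q \<longrightarrow> q \<in> set C \<or> q \<in> set (f C q) \<or>
      (\<forall>q'. legal_step G q q' \<longrightarrow> (\<exists>m<n. wins_within G m (f C q) q')))"
proof -
  have "\<exists>C'. list_all2 (legal_step G) C C' \<and>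
      (\<forall>n. wins_within G n C q \<longrightarrow> q \<in> set C \<or> q \<in> set C' \<or>
        (\<forall>q'. legal_step G q q' \<longrightarrow> (\<exists>m<n. wins_within G m C' q')))" for C q
  proof (cases "(\<exists>n. wins_within G n C q) \<and> q \<notin> set C")
    case False
    have "list_all2 (legal_step G) C C" by (simp add: list.rel_refl)
    then show ?thesis using False by blast
  next
    case True
    define n where "n = (LEAST n. wins_within G n C q)"
    have n: "wins_within G n C q" using True LeastI_ex unfolding n_def by metis
    have least: "n \<le> m" if "wins_within G m C q" for m
      using that unfolding n_def by (rule Least_le)
    obtain m where m: "n = Suc m" using n True by (cases n) auto
    then have "\<not> wins_within G m C q" using least[of m] by auto
    then obtain C' where "list_all2 (legal_step G) C C'"
        "q \<in> set C' \<or> (\<forall>q'. legal_step G q q' \<longrightarrow> wins_within G m C' q')"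
      using n m by auto
    moreover have "m < n'" if "wins_within G n' C q" for n' using least[OF that] m by simp
    ultimately show ?thesis by blast
  qed
  then show ?thesis by metis
qed

text \<open>The bound in \<open>wins_within\<close> drops every round until capture. The start is
  arbitrary because a chase begins wherever the cops stand at the first sighting.\<close>

lemma positional_strategy_captures:
  assumes G: "pair_graph G" and "connected (with_proj G)"
    and "cops_win G (\<lambda>_ _. True) captured k"
  obtains f where "\<And>C q. list_all2 (legal_step G) C (f C q)"
    and "\<And>D r. legal_robber G r \<Longrightarrow> length (D 0) = k \<Longrightarrow> set (D 0) \<subseteq> pverts G \<Longrightarrow>
      (\<And>t. D (Suc t) = f (D t) (r t)) \<Longrightarrow> some_moment captured D r"
proof -
  obtain f where f: "\<And>C q. list_all2 (legal_step G) C (f C q)"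
    and win: "\<And>n C q. wins_within G n C q \<Longrightarrow> q \<in> set C \<or> q \<in> set (f C q) \<or>
      (\<forall>q'. legal_step G q q' \<longrightarrow> (\<exists>m<n. wins_within G m (f C q) q'))"
    using positional_strategy[of G] by blast
  show ?thesis
  proof
    show "list_all2 (legal_step G) C (f C q)" for C q by (rule f)
    fix D r assume r: "legal_robber G r" and D: "length (D 0) = k" "set (D 0) \<subseteq> pverts G"
      and step: "\<And>t. D (Suc t) = f (D t) (r t)"
    have "wins_within G n (D t) (r t) \<Longrightarrow> some_moment captured D r" for n t
    proof (induction n arbitrary: t rule: less_induct)
      case (less n)
      show ?case
      proof (cases "r t \<in> set (D t) \<or> r t \<in> set (D (Suc t))")
        case True
        then show ?thesis by (auto simp: some_moment_def captured_def)
      next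
        case False
        then obtain m where "m < n" "wins_within G m (D (Suc t)) (r (Suc t))"
          using win[OF less.prems] r step by (auto simp: legal_robber_def)
        then show ?thesis by (rule less.IH)
      qed
    qed
    moreover have "r 0 \<in> pverts G" using r by (simp add: legal_robber_def)
    ultimately show "some_moment captured D r"
      using classical_win_from_anywhere[OF assms D] by blast
  qed
qed

section \<open>The patrol before the first sighting\<close>

text \<open>
  Until the first sighting all observations are \<open>None\<close>, so the cops follow a fixed trajectory. The
  strategy may prescribe illegal moves for observations that never occur; these are replaced by
  staying put.
\<close>

lemma seeing_patrol:
  assumes "pverts G \<noteq> {}" and "cops_win G vis vis k"
  obtains a where "legal_cops G k a"
    and "\<And>r. legal_robber G r \<Longrightarrow> some_moment vis a r"
proof -
  obtain \<sigma> where \<sigma>: "\<And>r c os. legal_robber G r \<Longrightarrow> strategy_run vis \<sigma> r c os \<Longrightarrow>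
      legal_cops G k c \<and> some_moment vis c r"
    using cops_win_strategy[OF assms(2)] by blast
  \<comment> \<open>Round 0 yields one observation and each later round two, hence
    \<open>2 * t + 1\<close> of them by the end of round \<open>t\<close>.\<close>
  define a where "a = rec_nat (\<sigma> []) (\<lambda>t C.
    let C' = \<sigma> (replicate (2 * t + 1) None) in if list_all2 (legal_step G) C C' then C' else C)"
  have a0: "a 0 = \<sigma> []" by (simp add: a_def)
  have a_legal: "list_all2 (legal_step G) (a t) (a (Suc t))" for t
    by (simp add: a_def Let_def list.rel_refl)
  have a_Suc: "a (Suc t) = \<sigma> (replicate (2 * t + 1) None)"
    if "list_all2 (legal_step G) (a t) (\<sigma> (replicate (2 * t + 1) None))" for t
    using that by (simp add: a_def Let_def)
  have run: "\<exists>c os. strategy_run vis \<sigma> r c os \<and> legal_cops G k c \<and> some_moment vis c r"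
    if "legal_robber G r" for r
    using run_exists[of vis] \<sigma>[OF that] by blast
  show ?thesis
  proof
    obtain v where v: "v \<in> pverts G" using assms(1) by blast
    then have "legal_robber G (\<lambda>_. v)" by (simp add: legal_robber_def)
    then have "length (\<sigma> []) = k \<and> set (\<sigma> []) \<subseteq> pverts G"
      using run unfolding run_def legal_cops_def by metis
    then show "legal_cops G k a" using a0 a_legal by (simp add: legal_cops_def)
    fix r assume r: "legal_robber G r"
    obtain c os where c: "strategy_run vis \<sigma> r c os" "legal_cops G k c" "some_moment vis c r"
      using run[OF r] by blast
    show "some_moment vis a r"
    proof (rule ccontr)
      assume "\<not> some_moment vis a r"
      then have unseen: "\<not> vis (a t) (r t)" "\<not> vis (a (Suc t)) (r t)" for t
        by (auto simp: some_moment_def)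
      \<comment> \<open>Without a sighting along \<open>a\<close> the strategy receives only
        \<open>None\<close>. Its moves are then legal, being those of an actual play, so the
        replacement never occurs and the run is \<open>a\<close> itself.\<close>
      have eq: "c t = a t \<and> os t = replicate (2 * t + 1) None" for t
      proof (induction t)
        case 0
        then show ?case using c(1) a0 unseen(1)[of 0] by (simp add: run_def observe_def)
      next
        case (Suc t)
        have "list_all2 (legal_step G) (c t) (c (Suc t))" "c (Suc t) = \<sigma> (os t)"
          using c by (simp_all add: run_def legal_cops_def)
        then have "c (Suc t) = a (Suc t)" using a_Suc[of t] Suc by simp
        moreover have "os (Suc t) = os t @
            [observe vis (c (Suc t)) (r t), observe vis (c (Suc t)) (r (Suc t))]"
          using c(1) by (simp add: run_def)
        ultimately show ?case
          using Suc unseen(1)[of "Suc t"] unseen(2)[of t]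
          by (simp add: observe_def replicate_app_Cons_same)
      qed
      then have "c = a" by blast
      then show False using c(3) \<open>\<not> some_moment vis a r\<close> by simp
    qed
  qed
qed

section \<open>Separating the tracker from the chasers\<close>

text \<open>The tracker at index \<open>i\<close> is split off and later reinserted by
  \<open>put\<close>. The order of the chasers is kept, as legality of moves matches cops by
  index.\<close>

definition others :: "nat \<Rightarrow> 'a list \<Rightarrow> 'a list" where
  "others i C = take i C @ drop (Suc i) C"

definition put :: "nat \<Rightarrow> 'a \<Rightarrow> 'a list \<Rightarrow> 'a list" where
  "put i x D = take i D @ x # drop i D"

lemma set_others: "set (others i C) \<subseteq> set C"
  by (auto simp: others_def dest: in_set_takeD in_set_dropD)

lemma length_others: "i < length C \<Longrightarrow> Suc (length (others i C)) = length C"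
  by (simp add: others_def)

lemma others_put: "i \<le> length D \<Longrightarrow> others i (put i x D) = D"
  by (simp add: others_def put_def)

lemma nth_put: "i \<le> length D \<Longrightarrow> put i x D ! i = x"
  by (simp add: put_def nth_append)

lemma list_all2_put:
  assumes "list_all2 R (others i C) D" and "R (C ! i) x" and "i < length C"
  shows "list_all2 R C (put i x D)"
proof -
  obtain D1 D2 where D: "D = D1 @ D2" "list_all2 R (take i C) D1" "list_all2 R (drop (Suc i) C) D2"
    using assms(1) by (auto simp: others_def list_all2_append1)
  have "length D1 = i" using list_all2_lengthD[OF D(2)] assms(3) by simp
  then have "put i x D = D1 @ x # D2" using D(1) by (simp add: put_def)
  moreover have "list_all2 R (take i C @ C ! i # drop (Suc i) C) (D1 @ x # D2)"
    using D(2,3) assms(2) by (intro list_all2_appendI) simp_all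
  ultimately show ?thesis using id_take_nth_drop[OF assms(3)] by simp
qed

section \<open>Tracking and chasing\<close>

text \<open>One cop tracks and the other \<open>k\<close> run the positional strategy, hence
  \<open>Suc k\<close>. The patrol \<open>a\<close> enters as a fixed trajectory, since nothing is
  learned before the first sighting.\<close>

lemma track_and_chase:
  assumes G: "pair_graph G" and "connected (with_proj G)" and l: "l \<ge> 2"
    and classical: "cops_win G (\<lambda>_ _. True) captured k"
    and a: "legal_cops G (Suc k) a" "\<And>r. legal_robber G r \<Longrightarrow> some_moment (in_range G l) a r"
  shows "cops_win G (in_range G l) captured (Suc k)"
proof -
  obtain f where f: "\<And>C q. list_all2 (legal_step G) C (f C q)"
    and chase: "\<And>D r. legal_robber G r \<Longrightarrow> length (D 0) = k \<Longrightarrow> set (D 0) \<subseteq> pverts G \<Longrightarrow>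
      (\<And>t. D (Suc t) = f (D t) (r t)) \<Longrightarrow> some_moment captured D r"
    using positional_strategy_captures[OF assms(1,2) classical] by blast
  \<comment> \<open>Ending at distance at most \<open>l - 1\<close> leaves room for one robber step
    without losing sight of him.\<close>
  have "\<exists>y. legal_step G x y \<and> (near G l x q \<longrightarrow> near G (l - 1) y q)" for x q
    using near_SucD[of G "l - 1" x q] l by (cases "near G l x q") (auto intro: legal_step_refl)
  then obtain toward where toward: "\<And>x q. legal_step G x (toward x q)"
    "\<And>x q. near G l x q \<Longrightarrow> near G (l - 1) (toward x q) q"
    by metis

  text \<open>
    The memory consists of the time, the cop position, the index of the tracker and the last
    vertex at which the robber was seen, if any.
  \<close>
  define track where "track C i x = (if i < length C \<and> near G l (C ! i) x then i
    else SOME j. j < length C \<and> near G l (C ! j) x)" for C i x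
  define heed where "heed C m ob =
    (case ob of None \<Rightarrow> m | Some x \<Rightarrow> (track C (fst m) x, Some x))"
    for C and m :: "nat \<times> 'a option" and ob
  \<comment> \<open>The index \<open>0\<close> is a placeholder until the first sighting.\<close>
  define ini where "ini ob = (0 :: nat, a 0, heed (a 0) (0, None) ob)" for ob
  define nxt where "nxt = (\<lambda>(t, C, i, qo). case qo of None \<Rightarrow> a (Suc t)
    | Some q \<Rightarrow> put i (toward (C ! i) q) (f (others i C) q))"
  \<comment> \<open>The sighting after the robber's move is newer and takes precedence; failing
    that, his vertex before the move is used.\<close>
  define upd where "upd s ob1 ob2 = (Suc (fst s), nxt s,
    heed (nxt s) (snd (snd s)) (case ob2 of None \<Rightarrow> ob1 | Some _ \<Rightarrow> ob2))" for s ob1 ob2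

  show ?thesis
  proof (rule cops_win_machine)
    fix r c s assume r: "legal_robber G r" and run: "run (in_range G l) (a 0) ini upd nxt r c s"
    define i where "i t = fst (snd (snd (s t)))" for t
    define qo where "qo t = snd (snd (snd (s t)))" for t
    have s: "s t = (t, c t, i t, qo t)" for t
      unfolding i_def qo_def using run
      by (induction t) (auto simp: run_def ini_def upd_def prod_eq_iff)
    have c_0: "c 0 = a 0" using run by (simp add: run_def)
    have c_None: "c (Suc t) = a (Suc t)" if "qo t = None" for t
      using run that by (simp add: run_def s nxt_def)
    have c_Some: "c (Suc t) = put (i t) (toward (c t ! i t) q) (f (others (i t) (c t)) q)"
      if "qo t = Some q" for t q
      using run that by (simp add: run_def s nxt_def)
    have m_0: "(i 0, qo 0) = heed (c 0) (0, None) (observe (in_range G l) (c 0) (r 0))"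
      using run s[of 0] by (simp add: run_def ini_def)
    have m_Suc: "(i (Suc t), qo (Suc t)) = heed (c (Suc t)) (i t, qo t)
        (if in_range G l (c (Suc t)) (r (Suc t)) then Some (r (Suc t))
         else observe (in_range G l) (c (Suc t)) (r t))" for t
    proof -
      have "s (Suc t) = upd (s t) (observe (in_range G l) (c (Suc t)) (r t))
          (observe (in_range G l) (c (Suc t)) (r (Suc t)))" "nxt (s t) = c (Suc t)"
        using run by (simp_all add: run_def)
      then show ?thesis unfolding s by (simp add: upd_def observe_def)
    qed

    have track: "track C j x < length C \<and> near G l (C ! track C j x) x"
      if "in_range G l C x" "set C \<subseteq> pverts G" for C j x
    proof -
      have "\<exists>j. j < length C \<and> near G l (C ! j) x"
        using that in_range_iff[OF G that(2)] by (auto simp: in_set_conv_nth)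
      from someI_ex[OF this] show ?thesis unfolding track_def by auto
    qed

    have inv: "length (c t) = Suc k \<and> set (c t) \<subseteq> pverts G \<and> (qo t = None \<longrightarrow> c t = a t) \<and>
        (qo t \<noteq> None \<longrightarrow> i t < Suc k)" (is "?inv t")
      and c_legal: "list_all2 (legal_step G) (c t) (c (Suc t))" for t
    proof -
      \<comment> \<open>Legality of a move rests on the invariant, and the invariant one round later
        on that legality; hence this conditional form first.\<close>
      have step: "list_all2 (legal_step G) (c t) (c (Suc t))" if inv: "?inv t" for t
      proof (cases "qo t")
        case None
        then show ?thesis using inv c_None a(1) by (simp add: legal_cops_def)
      next
        case (Some q)
        then show ?thesis
          unfolding c_Some[OF Some] using inv f toward(1) by (intro list_all2_put) auto
      qed
      have "?inv t" for t
      proof (induction t)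
        case 0
        have "length (a 0) = Suc k" "set (a 0) \<subseteq> pverts G"
          using a(1) by (simp_all add: legal_cops_def)
        then show ?case
          using m_0 track[of "c 0" "r 0" 0] c_0
          by (auto simp: heed_def observe_def split: if_splits)
      next
        case (Suc t)
        have len: "length (c (Suc t)) = Suc k" "set (c (Suc t)) \<subseteq> pverts G"
          using list_all2_lengthD[OF step[OF Suc]] legal_cops_step_in_verts[OF G step[OF Suc]] Suc
          by simp_all
        then show ?case
          using m_Suc[of t] track[of "c (Suc t)"] Suc c_None[of t]
          by (auto simp: heed_def observe_def split: if_splits)
      qed
      then show "?inv t" "list_all2 (legal_step G) (c t) (c (Suc t))" using step by blast+
    qed
    have in_range: "in_range G l (c t) x \<longleftrightarrow> (\<exists>y \<in> set (c t). near G l y x)" for t x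
      using in_range_iff[OF G] inv by blast
    have r_legal: "legal_step G (r t) (r (Suc t))" for t using r by (simp add: legal_robber_def)

    \<comment> \<open>The vertex \<open>q\<close> will be the robber's present position or his
      position one round ago.\<close>
    define tracked where "tracked t q \<longleftrightarrow>
      qo t = Some q \<and> i t < Suc k \<and> near G l (c t ! i t) q" for t q
    have tracker_close: "i t < Suc k \<and> near G (l - 1) (c (Suc t) ! i t) q \<and>
        others (i t) (c (Suc t)) = f (others (i t) (c t)) q" if "tracked t q" for t q
    proof -
      have "length (f (others (i t) (c t)) q) = k"
        using f[of "others (i t) (c t)" q] length_others[of "i t" "c t"] inv[of t] that
        by (auto simp: tracked_def dest: list_all2_lengthD)
      then show ?thesis
        using that toward(2) c_Some[of t q] by (simp add: tracked_def nth_put others_put)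
    qed
    \<comment> \<open>Cops and robber get separate offsets: \<open>t = u\<close> for a chase of the
      robber himself, \<open>t = Suc u\<close> for a chase of his shadow.\<close>
    have chase_from: "some_moment captured (\<lambda>n. others j (c (t + n))) (\<lambda>n. r (u + n))"
      if tr: "\<And>n. tracked (t + n) (r (u + n))" and j: "\<And>n. i (t + n) = j" for t u j
    proof (rule chase)
      show "legal_robber G (\<lambda>n. r (u + n))"
        using legal_robber_in_verts[OF G r] r_legal by (simp add: legal_robber_def)
      have "j < Suc k" using tr[of 0] j[of 0] by (simp add: tracked_def)
      then show "length (others j (c (t + 0))) = k"
        using length_others[of j "c t"] inv[of t] by simp
      show "set (others j (c (t + 0))) \<subseteq> pverts G" using set_others inv by fastforce
      show "others j (c (t + Suc n)) = f (others j (c (t + n))) (r (u + n))" for n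
        using tracker_close[OF tr[of n]] j[of n] by simp
    qed

    have l_steps: "near G l x (r (Suc t))" if "near G (l - 1) x (r t)" for x t
      using near_SucI[OF that r_legal] l by simp
    have keep: "track C j x = j" if "j < length C" "near G l (C ! j) x" for C j x
      using that by (simp add: track_def)

    have "some_moment captured c r" if seen: "in_range G l (c t) (r t)" for t
    proof -
      have "tracked t (r t)"
      proof (cases t)
        case 0
        then show ?thesis using m_0 seen track[of "c 0" "r 0" 0] inv[of 0]
          by (auto simp: tracked_def heed_def observe_def)
      next
        case (Suc t')
        then show ?thesis using m_Suc[of t'] seen track[of "c t" "r t"] inv[of t]
          by (auto simp: tracked_def heed_def)
      qed
      \<comment> \<open>After the robber's step he is again within \<open>l\<close> of the tracker,
        so the sighting and the index persist.\<close>
      moreover have "tracked (Suc t) (r (Suc t)) \<and> i (Suc t) = i t" if "tracked t (r t)" for t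
      proof -
        have close: "i t < Suc k" "near G l (c (Suc t) ! i t) (r (Suc t))"
          using tracker_close[OF that] l_steps by blast+
        then have "in_range G l (c (Suc t)) (r (Suc t))"
          unfolding in_range using inv[of "Suc t"] nth_mem by metis
        then show ?thesis
          using m_Suc[of t] close inv[of "Suc t"] by (auto simp: tracked_def heed_def keep)
      qed
      ultimately have tr: "tracked (t + n) (r (t + n)) \<and> i (t + n) = i t" for n
        by (induction n) auto
      then have "some_moment captured (\<lambda>n. others (i t) (c (t + n))) (\<lambda>n. r (t + n))"
        by (intro chase_from) auto
      then obtain n where "r (t + n) \<in> set (c (t + n)) \<or> r (t + n) \<in> set (c (Suc (t + n)))"
        using set_others by (fastforce simp: some_moment_def captured_def)
      then show ?thesis by (auto simp: some_moment_def captured_def)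
    qed

    moreover have "\<exists>t. in_range G l (c t) (r t)"
    proof (rule ccontr)
      assume "\<nexists>t. in_range G l (c t) (r t)"
      then have unseen: "\<not> in_range G l (c t) (r t)" for t by blast
      show False
      proof (cases "\<exists>t. in_range G l (c (Suc t)) (r t)")
        \<comment> \<open>With no sighting at either kind of moment the cops never leave the patrol,
          which must see him.\<close>
        case False
        have "qo t = None" for t
        proof (induction t)
          case 0
          then show ?case using m_0 unseen[of 0] by (simp add: heed_def observe_def)
        next
          case (Suc t)
          then show ?case using m_Suc[of t] unseen[of "Suc t"] False
            by (simp add: heed_def observe_def)
        qed
        then have "c = a" using inv by blast
        then show False using a(2)[OF r] unseen False by (auto simp: some_moment_def)
      next
        case True
        then obtain t where "in_range G l (c (Suc t)) (r t)" by blast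
        \<comment> \<open>He is unseen after his own move, so the memory holds his vertex before it:
          the shadow lags by one round.\<close>
        then have "tracked (Suc t) (r t)"
          using m_Suc[of t] unseen[of "Suc t"] track[of "c (Suc t)" "r t"] inv[of "Suc t"]
          by (auto simp: tracked_def heed_def observe_def)
        moreover have "tracked (Suc (Suc t)) (r (Suc t)) \<and> i (Suc (Suc t)) = i (Suc t)"
          if "tracked (Suc t) (r t)" for t
        proof -
          have close: "i (Suc t) < Suc k"
              "near G l (c (Suc (Suc t)) ! i (Suc t)) (r (Suc t))"
            using tracker_close[OF that] l_steps by blast+
          then have "in_range G l (c (Suc (Suc t))) (r (Suc t))"
            unfolding in_range using inv[of "Suc (Suc t)"] nth_mem by metis
          then show ?thesis
            using m_Suc[of "Suc t"] close inv[of "Suc (Suc t)"] unseen[of "Suc (Suc t)"]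
            by (auto simp: tracked_def heed_def observe_def keep)
        qed
        ultimately have tr: "tracked (Suc t + n) (r (t + n)) \<and> i (Suc t + n) = i (Suc t)" for n
          by (induction n) auto
        then have "some_moment captured (\<lambda>n. others (i (Suc t)) (c (Suc t + n))) (\<lambda>n. r (t + n))"
          by (intro chase_from) auto
        \<comment> \<open>When the cops are next to move, the robber is at most one step from
          \<open>r u\<close> in the first case and two in the second. As \<open>l \<ge> 2\<close>,
          the cop on \<open>r u\<close> sees him.\<close>
        then obtain u where u: "r u \<in> set (c (Suc u)) \<or> r u \<in> set (c (Suc (Suc u)))"
          using set_others by (fastforce simp: some_moment_def captured_def)
        have near1: "near G (Suc 0) (r u) (r (Suc u))" by (rule near_SucI[OF near_self r_legal])
        have near2: "near G (Suc (Suc 0)) (r u) (r (Suc (Suc u)))"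
          by (rule near_SucI[OF near1 r_legal])
        have "near G l (r u) (r (Suc u))" "near G l (r u) (r (Suc (Suc u)))"
          using near_mono[OF near1] near_mono[OF near2] l by simp_all
        then show False using u unseen[of "Suc u"] unseen[of "Suc (Suc u)"] in_range by blast
      qed
    qed
    ultimately have "some_moment captured c r" by blast
    moreover have "legal_cops G (Suc k) c" using inv[of 0] c_legal by (simp add: legal_cops_def)
    ultimately show "legal_cops G (Suc k) c \<and> some_moment captured c r" by blast
  qed
qed

section \<open>Comparing the three numbers\<close>

lemma cops_win_captured_imp_in_range:
  assumes "pair_graph G" and "cops_win G vis captured k"
  shows "cops_win G vis (in_range G l) k"
proof -
  have "in_range G l C q" if "captured C q" "q \<in> pverts G" for C q
    using that gdist_le_iff[OF assms(1), of q q l] near_self[of G l q, unfolded near_def]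
    by (auto simp: in_range_def captured_def)
  then have "some_moment (in_range G l) c r" if "legal_robber G r" "some_moment captured c r" for c r
    using that legal_robber_in_verts[OF assms(1)] unfolding some_moment_def by blast
  then show ?thesis using assms(2) unfolding cops_win_def by blast
qed

text \<open>Cops who see everything can blind themselves, passing to \<open>\<sigma>\<close> only
  what \<open>vis\<close> would show at the positions it prescribes.\<close>

lemma cops_win_imp_full_visibility:
  assumes "cops_win G vis goal k"
  shows "cops_win G (\<lambda>_ _. True) goal k"
proof -
  obtain \<sigma> where \<sigma>: "\<And>r c os. legal_robber G r \<Longrightarrow> strategy_run vis \<sigma> r c os \<Longrightarrow>
      legal_cops G k c \<and> some_moment goal c r"
    using cops_win_strategy[OF assms] by blast
  show ?thesis
  proof (rule cops_win_machine)
    fix r c os assume r: "legal_robber G r"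
      and "run (\<lambda>_ _. True) (\<sigma> []) (\<lambda>x. [observe vis (\<sigma> []) (the x)])
        (\<lambda>os x y. os @ [observe vis (\<sigma> os) (the x), observe vis (\<sigma> os) (the y)]) \<sigma> r c os"
    then have "strategy_run vis \<sigma> r c os" by (simp add: run_def observe_def)
    then show "legal_cops G k c \<and> some_moment goal c r" using \<sigma> r by blast
  qed
qed

lemma legal_cops_pad:
  "legal_cops G k c \<Longrightarrow> v \<in> pverts G \<Longrightarrow> legal_cops G (j + k) (\<lambda>t. replicate j v @ c t)"
  by (auto simp: legal_cops_def intro!: list_all2_appendI list.rel_refl)

text \<open>Extra cops are parked at \<open>v\<close>. Under full visibility the observations do not
  depend on where cops stand, so the original strategy runs unchanged.\<close>

lemma classical_win_mono:
  assumes "cops_win G (\<lambda>_ _. True) captured k" and "k \<le> k'" and v: "v \<in> pverts G"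
  shows "cops_win G (\<lambda>_ _. True) captured k'"
proof -
  obtain \<sigma> where \<sigma>: "\<And>r c os. legal_robber G r \<Longrightarrow> strategy_run (\<lambda>_ _. True) \<sigma> r c os \<Longrightarrow>
      legal_cops G k c \<and> some_moment captured c r"
    using cops_win_strategy[OF assms(1)] by blast
  define P where "P = replicate (k' - k) v"
  show ?thesis
  proof (rule cops_win_machine)
    fix r c os assume r: "legal_robber G r"
      and run: "run (\<lambda>_ _. True) (P @ \<sigma> []) (\<lambda>x. [x]) (\<lambda>os x y. os @ [x, y]) (\<lambda>os. P @ \<sigma> os) r c os"
    obtain c' os' where run': "strategy_run (\<lambda>_ _. True) \<sigma> r c' os'" using run_exists by blast
    have "c t = P @ c' t \<and> os t = os' t" for t
      using run run' by (induction t) (simp_all add: run_def observe_def)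
    then have "c = (\<lambda>t. P @ c' t)" by blast
    then show "legal_cops G k' c \<and> some_moment captured c r"
      using \<sigma>[OF r run'] legal_cops_pad[of G k c' v "k' - k"] v assms(2)
      by (auto simp: P_def some_moment_def captured_def)
  qed
qed

text \<open>A resting cop on every vertex wins at once; this makes the sets under
  \<open>LEAST\<close> nonempty.\<close>

lemma cops_win_everywhere:
  assumes "pair_graph G"
  shows "cops_win G vis captured (card (pverts G))"
proof -
  interpret pair_graph G by fact
  obtain C where C: "set C = pverts G" "length C = card (pverts G)"
    using finite_distinct_list[OF pair_finite_verts] distinct_card by metis
  show ?thesis
  proof (rule cops_win_machine)
    fix r c s assume r: "legal_robber G r"
      and run: "run vis C (\<lambda>_. ()) (\<lambda>_ _ _. ()) (\<lambda>_. C) r c s"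
    have "c t = C" for t using run by (cases t) (simp_all add: run_def)
    then show "legal_cops G (card (pverts G)) c \<and> some_moment captured c r"
      using C legal_robber_in_verts[OF assms r]
      by (simp add: legal_cops_def some_moment_def captured_def list.rel_refl)
  qed
qed

theorem theorem4p1:
  fixes G :: "'a pair_pre_digraph" and l :: nat
  assumes "pair_graph G" and "connected (with_proj G)" and "l \<ge> 2"
  shows "vis_seeing_number l G = vis_cop_number l G \<or>
    (cop_number G \<le> vis_cop_number l G \<and> vis_cop_number l G \<le> cop_number G + 1)"
proof -
  let ?vis = "in_range G l"
  \<comment> \<open>The number of chasers: with the tracker the cops number max(c', c + 1), which is
    positive, so the subtraction does not truncate.\<close>
  define k where "k = max (vis_seeing_number l G) (cop_number G + 1) - 1"
  have k: "cop_number G \<le> k" "vis_seeing_number l G \<le> Suc k"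
    "Suc k = max (vis_seeing_number l G) (cop_number G + 1)"
    by (auto simp: k_def)
  obtain v where v: "v \<in> pverts G"
    using assms(2) by (auto simp: connected_def strongly_connected_def)
  have vis: "cops_win G ?vis captured (vis_cop_number l G)"
    unfolding vis_cop_number_def by (rule LeastI) (rule cops_win_everywhere[OF assms(1)])
  have seeing: "cops_win G ?vis ?vis (vis_cop_number l G)"
    using cops_win_captured_imp_in_range[OF assms(1) vis] .
  then have seeing_le: "vis_seeing_number l G \<le> vis_cop_number l G"
    unfolding vis_seeing_number_def by (rule Least_le)
  have cop_le: "cop_number G \<le> vis_cop_number l G"
    unfolding cop_number_def by (rule Least_le) (rule cops_win_imp_full_visibility[OF vis])

  have "cops_win G (\<lambda>_ _. True) captured (cop_number G)"
    unfolding cop_number_def by (rule LeastI) (rule cops_win_everywhere[OF assms(1)])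
  then have classical: "cops_win G (\<lambda>_ _. True) captured k"
    using k(1) v by (rule classical_win_mono)
  have patrol: "cops_win G ?vis ?vis (vis_seeing_number l G)"
    unfolding vis_seeing_number_def using seeing by (rule LeastI)
  obtain a where a: "legal_cops G (vis_seeing_number l G) a"
      "\<And>r. legal_robber G r \<Longrightarrow> some_moment ?vis a r"
    using seeing_patrol[OF _ patrol] v by blast
  have "cops_win G ?vis captured (Suc k)"
  proof (rule track_and_chase[OF assms classical])
    \<comment> \<open>The surplus cops are parked at \<open>v\<close>; the patrol is a fixed
      trajectory, so what they see cannot alter it.\<close>
    let ?b = "\<lambda>t. replicate (Suc k - vis_seeing_number l G) v @ a t"
    show "legal_cops G (Suc k) ?b"
      using legal_cops_pad[OF a(1) v, of "Suc k - vis_seeing_number l G"] k(2) by simp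
    show "some_moment ?vis ?b r" if "legal_robber G r" for r
      using a(2)[OF that] by (auto simp: some_moment_def in_range_def)
  qed
  then have "vis_cop_number l G \<le> max (vis_seeing_number l G) (cop_number G + 1)"
    unfolding k(3)[symmetric] vis_cop_number_def by (rule Least_le)
  \<comment> \<open>If the maximum is c', then \<open>seeing_le\<close> gives equality; otherwise it
    is c + 1, and \<open>cop_le\<close> supplies the lower bound.\<close>
  then show ?thesis using seeing_le cop_le by linarith
qed

end
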